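(* Let $G_1$ and $G_2$ be graphs with independence numbers $\alpha_1 \geq \alpha_2$ and vertex sets $V_1$ and $V_2$. Let \begin{align*} b_j & \coloneqq \max \{j, \alpha_1+1-j\} \hbox{ and } \\ c_j & \coloneqq \max \{j, \alpha_1 + 1 - j + \sigma_{j - \alpha_2}(G_2)\}. \end{align*} \begin{enumerate} \item If $|V_2|\leq \alpha_1$ then \[\sigma(G_1 \vee G_2)=\min\left\{\sigma(G_1)\,,\displaystyle\min_{1 \leq j \leq \alpha_2} b_j\,,\displaystyle\min_{\alpha_2+1 \leq j \leq |V_2|} c_j\right\}.\] \item If $|V_2| \geq \alpha_1$ then \[\sigma(G_1 \vee G_2)=\min\left\{\sigma(G_1)\,,\displaystyle\min_{1 \leq j \leq \alpha_2} b_j\,,\displaystyle\min_{\alpha_2 +1 \leq j \leq \alpha_1} c_j\,,\,\sigma_{\alpha_1+1-\alpha_2}(G_2)\right\}.\] \end{enumerate}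
   Context: All graphs are finite, undirected and simple. $K_n$ is the complete graph and $\overline{K}_n$ the empty (edgeless) graph on $n$ vertices. $\alpha(G)$ is the independence number, $\Delta(G)$ the maximum degree, and $G_1\vee G_2$ the join (disjoint union plus all edges between the two graphs). For a nonempty graph $G=(V,E)$ the sensitivity is $\sigma(G)=\min\{\Delta(G[S]) : S\subseteq V,\ |S|>\alpha(G)\}$, and $\sigma(\overline{K}_n)=\infty$. For a nonempty graph $G$ and integer $k\le |V_G|-\alpha(G)$, the $k$-sensitivity is $\sigma_k(G)=0$ if $k\le 0$ and, for $1\le k\le |V_G|-\alpha(G)$, $\sigma_k(G)=\min\{\Delta(H): H \text{ an induced subgraph of } G \text{ on } \alpha(G)+k \text{ vertices}\}$; for the empty graph, $\sigma_k(\overline{K}_n)=0$ if $k\le 0$ and $\sigma_k(\overline{K}_n)=\infty$ if $1\le k\le n$. Note $\sigma_1(G)=\sigma(G)$. *)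

theory Defs
  imports
    "Graph_Theory.Pair_Digraph"
    "Graph_Theory.Digraph_Component"
    "HOL-Library.Extended_Nat"
begin

text \<open>
  Finite simple undirected graphs are those of the locale \<open>pair_graph\<close>: finite, loop-free,
  symmetric pair digraphs. An undirected edge is a pair of opposite arcs, so the degree of a
  vertex is its \<open>out_degree\<close>.
\<close>

text \<open>Unspecified on the graph with no vertices, to which it is never applied below.\<close>

definition max_degree :: "('a, 'b) pre_digraph \<Rightarrow> nat" where
  "max_degree G = Max (out_degree G ` verts G)"

definition indep_set :: "'a pair_pre_digraph \<Rightarrow> 'a set \<Rightarrow> bool" where
  "indep_set G S \<longleftrightarrow> S \<subseteq> pverts G \<and> (\<forall>u\<in>S. \<forall>v\<in>S. (u, v) \<notin> parcs G)"

definition independence_number :: "'a pair_pre_digraph \<Rightarrow> nat" where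
  "independence_number G = Max {card S |S. indep_set G S}"

definition graph_join ::
    "'a pair_pre_digraph \<Rightarrow> 'b pair_pre_digraph \<Rightarrow> ('a + 'b) pair_pre_digraph" where
  "graph_join G H = \<lparr>
     pverts = pverts G <+> pverts H,
     parcs = {(Inl u, Inl v) |u v. (u, v) \<in> parcs G}
           \<union> {(Inr u, Inr v) |u v. (u, v) \<in> parcs H}
           \<union> {(Inl u, Inr v) |u v. u \<in> pverts G \<and> v \<in> pverts H}
           \<union> {(Inr v, Inl u) |u v. u \<in> pverts G \<and> v \<in> pverts H}\<rparr>"

text \<open>
  An infimum in \<open>enat\<close> is an attained minimum when the index set is nonempty, and \<open>\<infinity>\<close> when it is
  empty. A nonempty graph is one with at least one edge.
\<close>

definition sensitivity :: "'a pair_pre_digraph \<Rightarrow> enat" where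
  "sensitivity G =
     (if parcs G = {} then \<infinity>
      else INF S \<in> {S. S \<subseteq> pverts G \<and> card S > independence_number G}.
             enat (max_degree (with_proj G \<restriction> S)))"

text \<open>
  The \<open>k\<close>-sensitivity is meant for \<open>k \<le> card (pverts G) - independence_number G\<close> (and for
  \<open>k \<le> card (pverts G)\<close> if \<open>G\<close> has no edges). For larger \<open>k\<close> this definition gives \<open>\<infinity>\<close>.
\<close>

definition k_sensitivity :: "int \<Rightarrow> 'a pair_pre_digraph \<Rightarrow> enat" where
  "k_sensitivity k G =
     (if k \<le> 0 then 0
      else if parcs G = {} then \<infinity>
      else INF S \<in> {S. S \<subseteq> pverts G \<and> int (card S) = int (independence_number G) + k}.
             enat (max_degree (with_proj G \<restriction> S)))"

lemma pair_graph_graph_join: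
  assumes "pair_graph G" "pair_graph H"
  shows "pair_graph (graph_join G H)"
proof -
  interpret G: pair_graph G by fact
  interpret H: pair_graph H by fact
  let ?J = "graph_join G H"
  have wf: "fst e \<in> pverts ?J \<and> snd e \<in> pverts ?J \<and> fst e \<noteq> snd e" if "e \<in> parcs ?J" for e
    using that G.in_arcsD1 G.in_arcsD2 H.in_arcsD1 H.in_arcsD2 G.no_loops' H.no_loops'
    by (auto simp: graph_join_def)
  have fin: "finite (pverts ?J)"
    using G.pair_finite_verts H.pair_finite_verts by (simp add: graph_join_def)
  have "parcs ?J \<subseteq> pverts ?J \<times> pverts ?J"
    using wf by (auto simp: mem_Times_iff)
  then have "finite (parcs ?J)"
    using fin by (meson finite_SigmaI finite_subset)
  moreover have "symmetric (with_proj ?J)"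
    unfolding symmetric_def using G.arcs_symmetric H.arcs_symmetric
    by (auto intro!: symI simp: graph_join_def)
  ultimately show ?thesis
    using wf fin by unfold_locales auto
qed

end

theory Submission
  imports Defs
begin

text \<open>
  The join has independence number \<open>\<alpha>1\<close>, and its sensitivity is attained on sets with exactly
  \<open>\<alpha>1 + 1\<close> vertices. Classify these sets by the number \<open>j\<close> of their vertices in \<open>G2\<close>. If both
  parts are nonempty, every vertex of the \<open>G1\<close>-part gains degree \<open>j\<close> and every vertex of the
  \<open>G2\<close>-part gains degree \<open>\<alpha>1 + 1 - j\<close>; as \<open>\<alpha>1 + 1 - j \<le> \<alpha>1\<close>, the \<open>G1\<close>-part may be taken
  independent, which leaves the least maximum degree over \<open>j\<close>-subsets of \<open>G2\<close>: it is \<open>0\<close> for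
  \<open>j \<le> \<alpha>2\<close> and a \<open>k\<close>-sensitivity beyond. The extreme values \<open>j = 0\<close> and \<open>j = \<alpha>1 + 1\<close> give the
  sensitivity of \<open>G1\<close> and the last \<open>k\<close>-sensitivity of \<open>G2\<close>. A value \<open>j > |V2|\<close> contributes \<open>\<infinity>\<close>.
\<close>

section \<open>Maximum degrees of induced subgraphs, in one graph and in a join\<close>

text \<open>The value at the empty set is an unspecified \<open>Max {}\<close>, which is why
  nonemptiness is assumed wherever degrees are bounded.\<close>

definition ideg :: "'a pair_pre_digraph \<Rightarrow> 'a set \<Rightarrow> nat" where
  "ideg G S = max_degree (with_proj G \<restriction> S)"

lemma out_degree_induced:
  assumes "u \<in> S"
  shows "out_degree (with_proj G \<restriction> S) u = card {v \<in> S. (u, v) \<in> parcs G}"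
proof -
  have "out_arcs (with_proj G \<restriction> S) u = Pair u ` {v \<in> S. (u, v) \<in> parcs G}"
    using assms by (auto simp: out_arcs_def induce_subgraph_def)
  then show ?thesis
    by (simp add: out_degree_def card_image inj_on_def)
qed

lemma ideg_eq: "ideg G S = Max ((\<lambda>u. card {v \<in> S. (u, v) \<in> parcs G}) ` S)"
proof -
  have "out_degree (with_proj G \<restriction> S) ` S = (\<lambda>u. card {v \<in> S. (u, v) \<in> parcs G}) ` S"
    by (rule image_cong) (simp_all add: out_degree_induced)
  then show ?thesis
    by (simp add: ideg_def max_degree_def)
qed

lemma ideg_mono:
  assumes "T \<subseteq> S" "T \<noteq> {}" "finite S"
  shows "ideg G T \<le> ideg G S"
proof -
  have fT: "finite T"
    using assms finite_subset by blast
  have "card {v \<in> T. (u, v) \<in> parcs G} \<le> ideg G S" if "u \<in> T" for u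
  proof -
    have "card {v \<in> T. (u, v) \<in> parcs G} \<le> card {v \<in> S. (u, v) \<in> parcs G}"
      using assms by (intro card_mono) auto
    also have "\<dots> \<le> ideg G S"
      unfolding ideg_eq using assms that by (intro Max_ge) auto
    finally show ?thesis .
  qed
  then show ?thesis
    unfolding ideg_eq[of G T] using assms fT by (intro Max.boundedI) auto
qed

lemma ideg_indep_set:
  assumes "indep_set G S" "S \<noteq> {}"
  shows "ideg G S = 0"
proof -
  have "{v \<in> S. (u, v) \<in> parcs G} = {}" if "u \<in> S" for u
    using assms that by (auto simp: indep_set_def)
  then show ?thesis
    using assms(2) by (simp add: ideg_eq image_constant_conv del: Collect_empty_eq)
qed

text \<open>One-sided vertex sets are treated separately: with an empty part, one of the two terms
  in \<open>ideg_join\<close> would be unspecified.\<close>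

lemma ideg_join_left: "ideg (graph_join G H) (S <+> {}) = ideg G S"
proof -
  have "{v \<in> S <+> {}. (Inl u, v) \<in> parcs (graph_join G H)} = Inl ` {v \<in> S. (u, v) \<in> parcs G}" for u
    by (auto simp: graph_join_def)
  then show ?thesis
    by (simp add: ideg_eq Plus_def image_image card_image)
qed

lemma ideg_join_right: "ideg (graph_join G H) ({} <+> S) = ideg H S"
proof -
  have "{v \<in> {} <+> S. (Inr u, v) \<in> parcs (graph_join G H)} = Inr ` {v \<in> S. (u, v) \<in> parcs H}" for u
    by (auto simp: graph_join_def)
  then show ?thesis
    by (simp add: ideg_eq Plus_def image_image card_image)
qed

text \<open>Each vertex keeps its neighbours on its own side and gains the whole other part, so all
  degrees on a side shift by the same constant, which passes through \<open>Max\<close>.\<close>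

lemma ideg_join:
  assumes "S \<subseteq> pverts G" "T \<subseteq> pverts H" "finite S" "finite T" "S \<noteq> {}" "T \<noteq> {}"
  shows "ideg (graph_join G H) (S <+> T) = max (ideg G S + card T) (ideg H T + card S)"
proof -
  let ?J = "graph_join G H"
  let ?d = "\<lambda>u. card {v \<in> S <+> T. (u, v) \<in> parcs ?J}"
  have l: "?d (Inl u) = card {v \<in> S. (u, v) \<in> parcs G} + card T" if "u \<in> S" for u
  proof -
    have "{v \<in> S <+> T. (Inl u, v) \<in> parcs ?J} = {v \<in> S. (u, v) \<in> parcs G} <+> T"
      using assms that by (auto simp: graph_join_def)
    then show ?thesis
      using assms by (simp add: card_Plus)
  qed
  have r: "?d (Inr u) = card {v \<in> T. (u, v) \<in> parcs H} + card S" if "u \<in> T" for u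
  proof -
    have "{v \<in> S <+> T. (Inr u, v) \<in> parcs ?J} = S <+> {v \<in> T. (u, v) \<in> parcs H}"
      using assms that by (auto simp: graph_join_def)
    then show ?thesis
      using assms by (simp add: card_Plus)
  qed
  have "?d ` (S <+> T) = (\<lambda>u. ?d (Inl u)) ` S \<union> (\<lambda>u. ?d (Inr u)) ` T"
    by (simp add: Plus_def image_Un image_image)
  also have "\<dots> = (\<lambda>u. card {v \<in> S. (u, v) \<in> parcs G} + card T) ` S
      \<union> (\<lambda>u. card {v \<in> T. (u, v) \<in> parcs H} + card S) ` T"
    using l r by simp
  finally show ?thesis
    using assms by (simp add: ideg_eq Max.union Max_add_commute)
qed

section \<open>Independent sets and sensitivities of a single graph\<close>

context pair_graph
begin

lemma finite_indep_cards: "finite {card S |S. indep_set G S}"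
proof -
  have "{card S |S. indep_set G S} \<subseteq> card ` Pow (pverts G)"
    by (auto simp: indep_set_def)
  then show ?thesis
    using finite_subset by fastforce
qed

lemma indep_set_card_le: "indep_set G S \<Longrightarrow> card S \<le> independence_number G"
  unfolding independence_number_def using finite_indep_cards by (intro Max_ge) auto

text \<open>A maximum independent set can be trimmed, since subsets of independent sets are
  independent.\<close>

lemma ex_indep_set:
  assumes "k \<le> independence_number G"
  obtains S where "indep_set G S" "card S = k"
proof -
  \<comment> \<open>This makes the set of cardinalities nonempty, so its maximum is
    attained.\<close>
  have "indep_set G {}"
    by (simp add: indep_set_def)
  then have "independence_number G \<in> {card S |S. indep_set G S}"
    unfolding independence_number_def using finite_indep_cards by (intro Max_in) auto
  then obtain S where S: "indep_set G S" "card S = independence_number G"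
    by auto
  then obtain T where "T \<subseteq> S" "card T = k"
    using assms by (metis obtain_subset_with_card_n)
  with S show ?thesis
    by (intro that[of T]) (auto simp: indep_set_def)
qed

lemma independence_number_le_card: "independence_number G \<le> card (pverts G)"
proof -
  obtain S where "indep_set G S" "card S = independence_number G"
    using ex_indep_set by blast
  then show ?thesis
    by (metis card_mono indep_set_def pair_finite_verts)
qed

lemma independence_number_edgeless:
  assumes "parcs G = {}"
  shows "independence_number G = card (pverts G)"
  using assms indep_set_card_le[of "pverts G"] independence_number_le_card
  by (simp add: indep_set_def)

text \<open>The edgeless case needs no exception: there the independence number is the number of
  vertices, no larger set exists, and the empty infimum is \<infinity>.\<close>

lemma k_sensitivity_eq:
  assumes "k > 0"
  shows "k_sensitivity (int k) G =
    (INF S \<in> {S. S \<subseteq> pverts G \<and> card S = independence_number G + k}. enat (ideg G S))"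
proof (cases "parcs G = {}")
  case True
  have "card S \<noteq> independence_number G + k" if "S \<subseteq> pverts G" for S
    using card_mono[OF pair_finite_verts that] assms independence_number_edgeless[OF True]
    by linarith
  then have "{S. S \<subseteq> pverts G \<and> card S = independence_number G + k} = {}"
    by blast
  with assms True show ?thesis
    unfolding k_sensitivity_def by (simp only: ) (simp add: top_enat_def)
next
  case False
  have "int (card S) = int (independence_number G) + int k
      \<longleftrightarrow> card S = independence_number G + k" for S :: "'a set"
    by linarith
  with assms False show ?thesis
    by (simp add: k_sensitivity_def ideg_def)
qed

text \<open>Passing to a subset does not increase the maximum degree, so only the smallest admissible
  sets matter.\<close>

lemma sensitivity_eq:
  "sensitivity G =
    (INF S \<in> {S. S \<subseteq> pverts G \<and> card S = independence_number G + 1}. enat (ideg G S))"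
    (is "_ = Inf (_ ` ?R)")
proof (cases "parcs G = {}")
  case True
  then show ?thesis
    using k_sensitivity_eq[of 1] by (simp add: sensitivity_def k_sensitivity_def)
next
  case False
  let ?L = "{S. S \<subseteq> pverts G \<and> card S > independence_number G}"
  have "\<exists>T\<in>?R. enat (ideg G T) \<le> enat (ideg G S)" if S: "S \<in> ?L" for S
  proof -
    obtain T where T: "T \<subseteq> S" "card T = independence_number G + 1"
      using S by (metis (mono_tags, lifting) Suc_eq_plus1 Suc_leI mem_Collect_eq
          obtain_subset_with_card_n)
    have "ideg G T \<le> ideg G S"
      using S T by (intro ideg_mono) (auto intro: finite_subset)
    with S T show ?thesis
      by auto
  qed
  then have "Inf ((\<lambda>S. enat (ideg G S)) ` ?L) = Inf ((\<lambda>S. enat (ideg G S)) ` ?R)"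
    by (intro antisym INF_superset_mono INF_mono) auto
  with False show ?thesis
    by (simp add: sensitivity_def ideg_def)
qed

text \<open>Supplies parts of least possible internal degree; \<open>0 < k\<close> keeps them
  nonempty.\<close>

lemma ideg_min_indep:
  assumes "0 < k" "k \<le> independence_number G"
  obtains S where "S \<subseteq> pverts G" "card S = k" "S \<noteq> {}" "ideg G S = 0"
proof -
  obtain S where "indep_set G S" "card S = k"
    using ex_indep_set assms(2) by blast
  moreover from this have "S \<noteq> {}"
    using assms(1) by auto
  ultimately show ?thesis
    by (intro that[of S]) (auto simp: ideg_indep_set, auto simp: indep_set_def)
qed

end

section \<open>Independent sets of a join\<close>

lemma Plus_vimage: "Inl -` S <+> Inr -` S = S"
proof (rule set_eqI)
  show "x \<in> Inl -` S <+> Inr -` S \<longleftrightarrow> x \<in> S" for x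
    by (cases x) auto
qed

text \<open>Vertices on opposite sides are always adjacent, so an independent set of the join lies
  within one side.\<close>

lemma independence_number_join:
  assumes "pair_graph G" "pair_graph H"
  shows "independence_number (graph_join G H)
    = max (independence_number G) (independence_number H)"
proof -
  interpret G: pair_graph G by fact
  interpret H: pair_graph H by fact
  interpret J: pair_graph "graph_join G H"
    using assms by (rule pair_graph_graph_join)
  obtain S where S: "indep_set G S" "card S = independence_number G"
    using G.ex_indep_set by blast
  then have "indep_set (graph_join G H) (Inl ` S)"
    by (auto simp: indep_set_def graph_join_def)
  then have 1: "independence_number G \<le> independence_number (graph_join G H)"
    using J.indep_set_card_le S by (fastforce simp: card_image)
  obtain S where S: "indep_set H S" "card S = independence_number H"
    using H.ex_indep_set by blast
  then have "indep_set (graph_join G H) (Inr ` S)"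
    by (auto simp: indep_set_def graph_join_def)
  then have 2: "independence_number H \<le> independence_number (graph_join G H)"
    using J.indep_set_card_le S by (fastforce simp: card_image)
  obtain S where S: "indep_set (graph_join G H) S" "card S = independence_number (graph_join G H)"
    using J.ex_indep_set by blast
  have l: "indep_set G (Inl -` S)" and r: "indep_set H (Inr -` S)"
    using S(1) by (auto simp: indep_set_def graph_join_def)
  have "Inl -` S = {} \<or> Inr -` S = {}"
  proof (rule ccontr)
    assume "\<not> ?thesis"
    then obtain u v where "Inl u \<in> S" "Inr v \<in> S"
      by auto
    moreover from this have "(Inl u, Inr v) \<in> parcs (graph_join G H)"
      using S(1) by (auto simp: indep_set_def graph_join_def)
    ultimately show False
      using S(1) by (auto simp: indep_set_def)
  qed
  then have "S = Inr ` (Inr -` S) \<or> S = Inl ` (Inl -` S)"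
    using Plus_vimage[of S] by (metis Plus_def image_empty sup_bot.left_neutral sup_bot.right_neutral)
  then have "card S = card (Inr -` S) \<or> card S = card (Inl -` S)"
    by (metis card_image inj_Inl inj_Inr)
  then have "card S \<le> max (independence_number G) (independence_number H)"
    using G.indep_set_card_le[OF l] H.indep_set_card_le[OF r] by auto
  with 1 2 S show ?thesis
    by simp
qed

section \<open>Splitting the vertex sets of a join by side\<close>

text \<open>If a side has too few vertices, the value is \<infinity>, so impossible splits do not
  affect a minimum.\<close>

definition split_sensitivity ::
    "'a pair_pre_digraph \<Rightarrow> 'b pair_pre_digraph \<Rightarrow> nat \<Rightarrow> nat \<Rightarrow> enat" where
  "split_sensitivity G H i j =
     (INF (S, T) \<in> {S. S \<subseteq> pverts G \<and> card S = i} \<times> {T. T \<subseteq> pverts H \<and> card T = j}.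
        enat (ideg (graph_join G H) (S <+> T)))"

locale two_pair_graphs = G: pair_graph G + H: pair_graph H
  for G :: "'a pair_pre_digraph" and H :: "'b pair_pre_digraph"
begin

lemma finite_left: "S \<subseteq> pverts G \<Longrightarrow> finite S"
  and finite_right: "T \<subseteq> pverts H \<Longrightarrow> finite T"
  by (auto intro: finite_subset)

text \<open>A vertex set of the join corresponds to its pair of preimages under \<open>Inl\<close>
  and \<open>Inr\<close>, whose cardinalities add up.\<close>

lemma sensitivity_join_split:
  assumes "independence_number H \<le> independence_number G"
  shows "sensitivity (graph_join G H) =
    (INF j \<in> {..independence_number G + 1}.
       split_sensitivity G H (independence_number G + 1 - j) j)"
    (is "?L = ?R")
proof -
  interpret J: pair_graph "graph_join G H"
    by (rule pair_graph_graph_join) unfold_locales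
  let ?a = "independence_number G"
  \<comment> \<open>By the assumption, the independence number of the join is
    \<open>?a\<close>.\<close>
  have L: "?L = (INF S \<in> {S. S \<subseteq> pverts G <+> pverts H \<and> card S = ?a + 1}.
      enat (ideg (graph_join G H) S))"
    using assms J.sensitivity_eq independence_number_join[OF G.pair_graph_axioms H.pair_graph_axioms]
    by (simp add: graph_join_def max_absorb1)
  show ?thesis
  proof (rule antisym)
    show "?L \<le> ?R"
      unfolding L split_sensitivity_def
    proof (intro INF_greatest)
      fix j p
      assume j: "j \<in> {..?a + 1}"
        and p: "p \<in> {S. S \<subseteq> pverts G \<and> card S = ?a + 1 - j} \<times> {T. T \<subseteq> pverts H \<and> card T = j}"
      show "(INF S \<in> {S. S \<subseteq> pverts G <+> pverts H \<and> card S = ?a + 1}.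
          enat (ideg (graph_join G H) S))
          \<le> (case p of (S, T) \<Rightarrow> enat (ideg (graph_join G H) (S <+> T)))"
        using j p by (cases p) (auto intro!: INF_lower simp: card_Plus finite_left finite_right)
    qed
    show "?R \<le> ?L"
      unfolding L
    proof (intro INF_greatest)
      fix S :: "('a + 'b) set"
      let ?S = "Inl -` S" and ?T = "Inr -` S"
      assume S: "S \<in> {S. S \<subseteq> pverts G <+> pverts H \<and> card S = ?a + 1}"
      then have sub: "?S \<subseteq> pverts G" "?T \<subseteq> pverts H"
        by auto
      then have "card S = card ?S + card ?T"
        using card_Plus[of ?S ?T] by (simp add: Plus_vimage finite_left finite_right)
      then have c: "card ?T \<le> ?a + 1" "card ?S = ?a + 1 - card ?T"
        using S by auto
      have "split_sensitivity G H (?a + 1 - card ?T) (card ?T)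
          \<le> enat (ideg (graph_join G H) (?S <+> ?T))"
        unfolding split_sensitivity_def using sub c by (intro INF_lower2[of "(?S, ?T)"]) auto
      then show "?R \<le> enat (ideg (graph_join G H) S)"
        using c by (intro INF_lower2[of "card ?T"]) (auto simp: Plus_vimage)
    qed
  qed
qed

lemma split_sensitivity_left:
  "split_sensitivity G H i 0 = (INF S \<in> {S. S \<subseteq> pverts G \<and> card S = i}. enat (ideg G S))"
proof -
  have "{T. T \<subseteq> pverts H \<and> card T = 0} = {{}}"
    by (auto dest: finite_right)
  moreover have "A \<times> {{} :: 'b set} = (\<lambda>S. (S, {})) ` A" for A :: "'a set set"
    by auto
  ultimately show ?thesis
    unfolding split_sensitivity_def by (simp only: image_image ideg_join_left prod.case)
qed

lemma split_sensitivity_right: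
  "split_sensitivity G H 0 j = (INF T \<in> {T. T \<subseteq> pverts H \<and> card T = j}. enat (ideg H T))"
proof -
  have "{S. S \<subseteq> pverts G \<and> card S = 0} = {{}}"
    by (auto dest: finite_left)
  moreover have "{{} :: 'a set} \<times> A = (\<lambda>T. ({}, T)) ` A" for A :: "'b set set"
    by auto
  ultimately show ?thesis
    unfolding split_sensitivity_def by (simp only: image_image ideg_join_right prod.case)
qed

text \<open>The lower bound drops the degrees inside the left part. It is attained by an independent
  left part, available as \<open>i\<close> is at most the independence number, with an optimal right
  part.\<close>

lemma split_sensitivity_eq:
  assumes "0 < i" "i \<le> independence_number G" "0 < j"
  shows "split_sensitivity G H i j =
    max (enat j) (enat i + (INF T \<in> {T. T \<subseteq> pverts H \<and> card T = j}. enat (ideg H T)))"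
    (is "_ = max _ (_ + Inf (_ ` ?\<T>))")
proof (rule antisym)
  let ?m = "INF T \<in> ?\<T>. enat (ideg H T)"
  show "max (enat j) (enat i + ?m) \<le> split_sensitivity G H i j"
    unfolding split_sensitivity_def
  proof (intro INF_greatest, clarify)
    fix S T
    assume S: "S \<subseteq> pverts G" "i = card S" and T: "T \<subseteq> pverts H" "j = card T"
    then have ne: "S \<noteq> {}" "T \<noteq> {}"
      using assms by auto
    have "?m \<le> enat (ideg H T)"
      using T by (intro INF_lower) simp
    then have "enat i + ?m \<le> enat (ideg H T + i)"
      by (metis add.commute add_left_mono plus_enat_simps(1))
    also have "\<dots> \<le> enat (ideg (graph_join G H) (S <+> T))"
      using S T ne by (simp add: ideg_join finite_left finite_right)
    finally show "max (enat (card T))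
        (enat (card S) + (INF T' \<in> {T'. T' \<subseteq> pverts H \<and> card T' = card T}. enat (ideg H T')))
        \<le> enat (ideg (graph_join G H) (S <+> T))"
      using S T ne by (simp add: ideg_join finite_left finite_right)
  qed
  show "split_sensitivity G H i j \<le> max (enat j) (enat i + ?m)"
  proof (cases "?\<T> = {}")
    case True
    then have "?m = \<infinity>"
      by (simp only: ) (simp add: top_enat_def)
    then show ?thesis
      by simp
  next
    case False
    \<comment> \<open>A nonempty infimum in \<open>enat\<close> is a least element, hence
      attained.\<close>
    then have "?m \<in> (\<lambda>T. enat (ideg H T)) ` ?\<T>"
      by (metis (no_types, lifting) Inf_enat_def LeastI_ex ex_in_conv image_is_empty)
    then obtain T where T: "T \<subseteq> pverts H" "card T = j" and m: "?m = enat (ideg H T)"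
      by blast
    obtain S where S: "S \<subseteq> pverts G" "card S = i" "S \<noteq> {}" "ideg G S = 0"
      using G.ideg_min_indep assms by metis
    have "T \<noteq> {}"
      using T assms by auto
    then have "ideg (graph_join G H) (S <+> T) = max j (i + ideg H T)"
      using S T by (simp add: ideg_join finite_left finite_right add.commute)
    then have "split_sensitivity G H i j \<le> enat (max j (i + ideg H T))"
      unfolding split_sensitivity_def using S T by (intro INF_lower2[of "(S, T)"]) auto
    then show ?thesis
      unfolding m by (simp add: max_def split: if_splits)
  qed
qed

section \<open>Evaluating the contribution of the right graph\<close>

lemma INF_ideg_right_indep:
  assumes "0 < j" "j \<le> independence_number H"
  shows "(INF T \<in> {T. T \<subseteq> pverts H \<and> card T = j}. enat (ideg H T)) = 0"
proof -
  obtain T where "T \<subseteq> pverts H" "card T = j" "ideg H T = 0"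
    using H.ideg_min_indep assms by metis
  then have "(INF T \<in> {T. T \<subseteq> pverts H \<and> card T = j}. enat (ideg H T)) \<le> 0"
    by (intro INF_lower2[of T]) (auto simp: zero_enat_def)
  then show ?thesis
    by simp
qed

lemma INF_ideg_right_above:
  assumes "independence_number H < j"
  shows "(INF T \<in> {T. T \<subseteq> pverts H \<and> card T = j}. enat (ideg H T))
    = k_sensitivity (int j - int (independence_number H)) H"
  using H.k_sensitivity_eq[of "j - independence_number H"] assms by (simp add: of_nat_diff)

text \<open>No subset has \<open>j\<close> elements. This removes the terms beyond the order of the
  second graph when that order is at most the larger independence number.\<close>

lemma k_sensitivity_right_infinite:
  assumes "card (pverts H) < j"
  shows "k_sensitivity (int j - int (independence_number H)) H = \<infinity>"
proof -
  have "{T. T \<subseteq> pverts H \<and> card T = j} = {}"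
    using assms by (auto dest: card_mono[OF H.pair_finite_verts])
  then have "(INF T \<in> {T. T \<subseteq> pverts H \<and> card T = j}. enat (ideg H T)) = \<infinity>"
    by (simp only: ) (simp add: top_enat_def)
  then show ?thesis
    using INF_ideg_right_above assms H.independence_number_le_card by auto
qed

text \<open>A single formula serving both cases; ranges that are empty contribute
  \<infinity>.\<close>

lemma sensitivity_join:
  assumes "independence_number H \<le> independence_number G"
  defines "a \<equiv> independence_number G" and "a' \<equiv> independence_number H"
  shows "sensitivity (graph_join G H) = Min {sensitivity G,
    INF j \<in> {1..a'}. enat (max j (a + 1 - j)),
    INF j \<in> {a' + 1..a}. max (enat j) (enat (a + 1 - j) + k_sensitivity (int j - int a') H),
    k_sensitivity (int a + 1 - int a') H}"
proof -
  let ?m = "\<lambda>j. split_sensitivity G H (a + 1 - j) j"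
  have "{..a + 1} = {0} \<union> {1..a'} \<union> {a' + 1..a} \<union> {a + 1}"
    using assms by auto
  then have "sensitivity (graph_join G H) =
      inf (inf (inf (?m 0) (INF j \<in> {1..a'}. ?m j)) (INF j \<in> {a' + 1..a}. ?m j)) (?m (a + 1))"
    unfolding sensitivity_join_split[OF assms(1)] a_def[symmetric]
    by (simp only: INF_union INF_insert) (simp add: INF_union)
  moreover have "?m 0 = sensitivity G"
    by (simp add: split_sensitivity_left G.sensitivity_eq a_def)
  moreover have "?m (a + 1) = k_sensitivity (int a + 1 - int a') H"
    using INF_ideg_right_above[of "a + 1"] assms by (simp add: split_sensitivity_right algebra_simps)
  \<comment> \<open>Here and in the next range \<open>1 \<le> j \<le> a\<close>, so the left size
    \<open>a + 1 - j\<close> lies between 1 and \<open>a\<close>, as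
    \<open>split_sensitivity_eq\<close> requires.\<close>
  moreover have "(INF j \<in> {1..a'}. ?m j) = (INF j \<in> {1..a'}. enat (max j (a + 1 - j)))"
    using assms by (intro INF_cong) (auto simp: split_sensitivity_eq INF_ideg_right_indep max_def)
  moreover have "(INF j \<in> {a' + 1..a}. ?m j) = (INF j \<in> {a' + 1..a}.
      max (enat j) (enat (a + 1 - j) + k_sensitivity (int j - int a') H))"
    using assms by (intro INF_cong) (auto simp: split_sensitivity_eq INF_ideg_right_above)
  ultimately show ?thesis
    by (simp add: inf_min min.assoc)
qed

end

theorem theorem3p1:
  fixes G1 :: "'a pair_pre_digraph" and G2 :: "'b pair_pre_digraph"
    and \<alpha>1 \<alpha>2 :: nat
    and b :: "nat \<Rightarrow> nat" and c :: "nat \<Rightarrow> enat"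
  assumes "pair_graph G1" and "pair_graph G2"
    and "\<alpha>1 = independence_number G1" and "\<alpha>2 = independence_number G2"
    and "\<alpha>1 \<ge> \<alpha>2"
    and "\<And>j. b j = max j (\<alpha>1 + 1 - j)"
    and "\<And>j. c j = max (enat j) (enat (\<alpha>1 + 1 - j) + k_sensitivity (int j - int \<alpha>2) G2)"
  shows "(card (pverts G2) \<le> \<alpha>1 \<longrightarrow>
           sensitivity (graph_join G1 G2) =
             Min {sensitivity G1,
                  INF j \<in> {1..\<alpha>2}. enat (b j),
                  INF j \<in> {\<alpha>2 + 1..card (pverts G2)}. c j})
       \<and> (card (pverts G2) \<ge> \<alpha>1 \<longrightarrow>
           sensitivity (graph_join G1 G2) =
             Min {sensitivity G1,
                  INF j \<in> {1..\<alpha>2}. enat (b j),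
                  INF j \<in> {\<alpha>2 + 1..\<alpha>1}. c j,
                  k_sensitivity (int \<alpha>1 + 1 - int \<alpha>2) G2})"
proof -
  interpret two_pair_graphs G1 G2
    using assms(1,2) by (rule two_pair_graphs.intro)
  \<comment> \<open>This is already the second case; the first follows by discarding infinite
    terms.\<close>
  have main: "sensitivity (graph_join G1 G2) = Min {sensitivity G1,
      INF j \<in> {1..\<alpha>2}. enat (b j), INF j \<in> {\<alpha>2 + 1..\<alpha>1}. c j,
      k_sensitivity (int \<alpha>1 + 1 - int \<alpha>2) G2}"
    unfolding assms(6,7) using sensitivity_join assms(3-5) by simp
  have "sensitivity (graph_join G1 G2) = Min {sensitivity G1,
      INF j \<in> {1..\<alpha>2}. enat (b j), INF j \<in> {\<alpha>2 + 1..card (pverts G2)}. c j}"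
    if le: "card (pverts G2) \<le> \<alpha>1"
  proof -
    \<comment> \<open>The cut is legitimate because \<alpha>2 is at most the number of vertices of
      \<open>G2\<close>.\<close>
    have "{\<alpha>2 + 1..\<alpha>1} = {\<alpha>2 + 1..card (pverts G2)} \<union> {card (pverts G2) + 1..\<alpha>1}"
      using le H.independence_number_le_card assms(4) by auto
    moreover have "c j = top" if "j \<in> {card (pverts G2) + 1..\<alpha>1}" for j
      using that assms(4,7) by (simp add: k_sensitivity_right_infinite top_enat_def)
    then have "(INF j \<in> {card (pverts G2) + 1..\<alpha>1}. c j) = top"
      by (simp add: INF_eq_const cong: INF_cong)
    \<comment> \<open>The last term is the case \<open>j = \<alpha>1 + 1\<close>, which also exceeds
      the number of vertices of \<open>G2\<close>.\<close>
    moreover have "k_sensitivity (int \<alpha>1 + 1 - int \<alpha>2) G2 = \<infinity>"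
      using k_sensitivity_right_infinite[of "\<alpha>1 + 1"] le assms(4) by (simp add: algebra_simps)
    ultimately show ?thesis
      unfolding main by (simp add: INF_union inf_top_right flip: top_enat_def)
  qed
  with main show ?thesis
    by blast
qed

end
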